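(* Let $G$ be a finite group and let $Max_G=\{x_1,\dots,x_m\}$ be an essential cyclic set of $G$ with $m\geq 4$. If $icn(G)=2$, then $rc(\Gamma_G^e)=3$.
   Context: Let $G$ be a finite group with identity $e$. The enhanced power graph $\Gamma_G^e$ has vertex set $G$, two distinct vertices $x,y$ being adjacent iff $x,y\in\langle z\rangle$ for some $z\in G$. For a connected graph $\Gamma$, an edge-colouring $\zeta:E(\Gamma)\to\{1,\dots,k\}$ (not necessarily proper) is a rainbow $k$-colouring if every pair of distinct vertices is joined by a path whose edges have pairwise distinct colours; $rc(\Gamma)$ is the minimum such $k$. An essential cyclic set $Max_G=\{x_1,\dots,x_m\}$ is a set of elements of $G$ such that $\langle x_1\rangle,\dots,\langle x_m\rangle$ are pairwise distinct and are exactly the maximal cyclic subgroups of $G$. The independence cyclic set is $ics(G)=\{x_i\in Max_G:\langle x_i\rangle\cap\langle x_j\rangle=\{e\}\text{ for all }j\neq i\}$ and $icn(G)=|ics(G)|$. *)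

theory Defs
  imports "HOL-Algebra.Generated_Groups"
begin

text \<open>A simple undirected graph is a pair of a vertex set and a set of two-element edges.\<close>

type_synonym 'a ugraph = "'a set \<times> 'a set set"

definition path_edges :: "'a list \<Rightarrow> 'a set list" where
  "path_edges p = map2 (\<lambda>u v. {u, v}) p (tl p)"

definition ugraph_path :: "'a ugraph \<Rightarrow> 'a \<Rightarrow> 'a list \<Rightarrow> 'a \<Rightarrow> bool" where
  "ugraph_path \<Gamma> u p v \<longleftrightarrow>
     p \<noteq> [] \<and> hd p = u \<and> last p = v \<and> distinct p \<and>
     set p \<subseteq> fst \<Gamma> \<and> set (path_edges p) \<subseteq> snd \<Gamma>"

definition rainbow_colouring :: "'a ugraph \<Rightarrow> nat \<Rightarrow> ('a set \<Rightarrow> nat) \<Rightarrow> bool" where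
  "rainbow_colouring \<Gamma> k \<zeta> \<longleftrightarrow>
     \<zeta> ` snd \<Gamma> \<subseteq> {1..k} \<and>
     (\<forall>u \<in> fst \<Gamma>. \<forall>v \<in> fst \<Gamma>. u \<noteq> v \<longrightarrow>
        (\<exists>p. ugraph_path \<Gamma> u p v \<and> distinct (map \<zeta> (path_edges p))))"

text \<open>The minimum below exists for every finite connected graph, since one may give all
  edges different colours; for a disconnected graph the value is unspecified. An enhanced
  power graph is connected because the identity is adjacent to every other vertex.\<close>

definition rainbow_connection_number :: "'a ugraph \<Rightarrow> nat" where
  "rainbow_connection_number \<Gamma> = (LEAST k. \<exists>\<zeta>. rainbow_colouring \<Gamma> k \<zeta>)"

definition enhanced_power_graph :: "('a, 'b) monoid_scheme \<Rightarrow> 'a ugraph" where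
  "enhanced_power_graph G =
     (carrier G,
      {{x, y} | x y. x \<in> carrier G \<and> y \<in> carrier G \<and> x \<noteq> y \<and>
         (\<exists>z \<in> carrier G. x \<in> generate G {z} \<and> y \<in> generate G {z})})"

definition cyclic_subgroups :: "('a, 'b) monoid_scheme \<Rightarrow> 'a set set" where
  "cyclic_subgroups G = {generate G {x} | x. x \<in> carrier G}"

definition maximal_cyclic_subgroups :: "('a, 'b) monoid_scheme \<Rightarrow> 'a set set" where
  "maximal_cyclic_subgroups G =
     {H \<in> cyclic_subgroups G. \<forall>K \<in> cyclic_subgroups G. H \<subseteq> K \<longrightarrow> K = H}"

definition essential_cyclic_set :: "('a, 'b) monoid_scheme \<Rightarrow> 'a set \<Rightarrow> bool" where
  "essential_cyclic_set G M \<longleftrightarrow>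
     M \<subseteq> carrier G \<and>
     bij_betw (\<lambda>x. generate G {x}) M (maximal_cyclic_subgroups G)"

text \<open>The essential cyclic set \<open>M\<close> is a parameter, as \<open>ics\<close> is a subset of the chosen
  generators; its cardinality does not depend on the choice.\<close>

definition ics :: "('a, 'b) monoid_scheme \<Rightarrow> 'a set \<Rightarrow> 'a set" where
  "ics G M =
     {x \<in> M. \<forall>y \<in> M. y \<noteq> x \<longrightarrow> generate G {x} \<inter> generate G {y} = {\<one>\<^bsub>G\<^esub>}}"

definition icn :: "('a, 'b) monoid_scheme \<Rightarrow> 'a set \<Rightarrow> nat" where
  "icn G M = card (ics G M)"

end

theory Submission imports Defs
begin

text \<open>
  Let \<open>A\<close> and \<open>B\<close> be the two maximal cyclic subgroups that meet every other one trivially.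
  A neighbour of a nontrivial element of \<open>A\<close> lies in \<open>A\<close>, so a path with at most two edges from
  such an element to a vertex outside \<open>A\<close> passes through the identity in the middle; the same
  holds for \<open>B\<close>. Hence the three edges joining the identity to the generators of \<open>A\<close>, of \<open>B\<close>
  and of a third maximal cyclic subgroup have different colours.

  For a colouring with three colours, let \<open>S\<close> be the set of chosen generators of the other
  maximal cyclic subgroups and \<open>T\<close> the set of all remaining nontrivial elements. Every vertex
  of \<open>S\<close> has a neighbour in \<open>T\<close>, because its cyclic subgroup meets another one nontrivially,
  and every vertex of \<open>T\<close> has a neighbour in \<open>S\<close>. An edge from the identity gets colour 1, 2,
  3 or 1 if it ends in \<open>A\<close>, \<open>B\<close>, \<open>S\<close> or \<open>T\<close>, and all other edges get colour 2. Nonadjacent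
  vertices whose edges to the identity have the same colour are joined by a path that leaves
  the identity towards \<open>T\<close> or \<open>S\<close> and ends with an edge of colour 2.
\<close>

section \<open>Edge lists and the length of rainbow paths\<close>

lemma path_edges_simps [simp]:
  "path_edges [x] = []"
  "path_edges (x # y # p) = {x, y} # path_edges (y # p)"
  by (simp_all add: path_edges_def)

lemma length_path_edges: "length (path_edges p) = length p - 1"
  by (simp add: path_edges_def)

text \<open>The edges have distinct colours in \<open>{1..k}\<close>, so there are at most
  \<open>k\<close> of them; the list of vertices has one entry more.\<close>

lemma rainbow_path_length_le:
  assumes "rainbow_colouring \<Gamma> k \<zeta>" "ugraph_path \<Gamma> u p v" "distinct (map \<zeta> (path_edges p))"
  shows "length p \<le> Suc k"
proof -
  have "set (map \<zeta> (path_edges p)) \<subseteq> {1..k}"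
    using assms(1,2) unfolding rainbow_colouring_def ugraph_path_def set_map by blast
  then have "card (set (map \<zeta> (path_edges p))) \<le> card {1..k}"
    by (intro card_mono) auto
  then show ?thesis
    using distinct_card[OF assms(3)] by (simp add: length_path_edges)
qed

lemma list_length_le_3_cases:
  assumes "p \<noteq> []" "length p \<le> 3"
  obtains x where "p = [x]" | x y where "p = [x, y]" | x y z where "p = [x, y, z]"
proof (cases "tl p")
  case Nil
  with assms that(1) show ?thesis by (cases p) auto
next
  case (Cons y q)
  with assms obtain x where "p = x # y # q" by (cases p) auto
  with assms that show ?thesis by (cases q; cases "tl q") auto
qed

section \<open>Maximal cyclic subgroups and adjacency\<close>

locale finite_group_essential = group G
  for G (structure) +
  fixes M :: "'a set"
  assumes finite_carrier: "finite (carrier G)"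
    and essential: "essential_cyclic_set G M"
begin

abbreviation cyc :: "'a \<Rightarrow> 'a set" where
  "cyc x \<equiv> generate G {x}"

lemma M_carrier: "x \<in> M \<Longrightarrow> x \<in> carrier G"
  using essential by (auto simp: essential_cyclic_set_def)

lemma cyc_subset_carrier: "x \<in> carrier G \<Longrightarrow> cyc x \<subseteq> carrier G"
  by (simp add: generate_incl)

lemma self_in_cyc: "x \<in> cyc x"
  by (simp add: generate.incl)

lemma cyc_mono:
  assumes "x \<in> carrier G" "y \<in> cyc x"
  shows "cyc y \<subseteq> cyc x"
  using assms by (simp add: generate_is_subgroup generate_subgroup_incl)

lemma cyc_inj: "x \<in> M \<Longrightarrow> y \<in> M \<Longrightarrow> cyc x = cyc y \<Longrightarrow> x = y"
  using essential by (auto simp: essential_cyclic_set_def bij_betw_def inj_on_def)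

text \<open>Maximality of \<open>cyc x\<close> turns the inclusion in \<open>cyc y\<close> into
  equality, and \<open>M\<close> has only one generator for each maximal cyclic subgroup.\<close>

lemma in_cyc_imp_eq:
  assumes "x \<in> M" "y \<in> M" "x \<in> cyc y"
  shows "x = y"
proof -
  have "cyc x \<in> maximal_cyclic_subgroups G"
    using essential assms(1) by (auto simp: essential_cyclic_set_def bij_betw_def)
  moreover have "cyc y \<in> cyclic_subgroups G"
    using assms(2) M_carrier by (auto simp: cyclic_subgroups_def)
  ultimately have "cyc y = cyc x"
    using cyc_mono assms M_carrier by (simp add: maximal_cyclic_subgroups_def)
  then show ?thesis
    using cyc_inj assms by blast
qed

lemma cyc_subset_maximal:
  assumes "z \<in> carrier G"
  obtains m where "m \<in> M" "cyc z \<subseteq> cyc m"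
proof -
  have "finite (cyclic_subgroups G)"
    by (rule finite_subset[of _ "Pow (carrier G)"])
      (use cyc_subset_carrier finite_carrier in \<open>auto simp: cyclic_subgroups_def\<close>)
  moreover have "cyc z \<in> cyclic_subgroups G"
    using assms by (auto simp: cyclic_subgroups_def)
  ultimately obtain H where H: "H \<in> cyclic_subgroups G" "cyc z \<subseteq> H"
    "\<forall>K \<in> cyclic_subgroups G. H \<subseteq> K \<longrightarrow> H = K"
    using finite_has_maximal2 by metis
  then have "H \<in> maximal_cyclic_subgroups G"
    by (auto simp: maximal_cyclic_subgroups_def)
  then obtain m where "m \<in> M" "H = cyc m"
    using essential unfolding essential_cyclic_set_def bij_betw_def by blast
  with H that show ?thesis by blast
qed

lemma in_maximal:
  assumes "z \<in> carrier G"
  obtains m where "m \<in> M" "z \<in> cyc m"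
  using cyc_subset_maximal[OF assms] self_in_cyc by blast

text \<open>Any cyclic subgroup witnessing adjacency extends to a maximal one, so generators in
  \<open>M\<close> suffice as witnesses.\<close>

lemma edge_iff:
  "{x, y} \<in> snd (enhanced_power_graph G) \<longleftrightarrow> x \<noteq> y \<and> (\<exists>m \<in> M. x \<in> cyc m \<and> y \<in> cyc m)"
  (is "?E \<longleftrightarrow> ?R")
proof
  assume ?E
  then obtain x' y' z where "{x, y} = {x', y'}" "x' \<noteq> y'" "z \<in> carrier G" "x' \<in> cyc z" "y' \<in> cyc z"
    unfolding enhanced_power_graph_def snd_conv by blast
  moreover from this obtain m where "m \<in> M" "cyc z \<subseteq> cyc m"
    using cyc_subset_maximal by metis
  ultimately show ?R
    by (auto simp: doubleton_eq_iff)
next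
  assume ?R
  then obtain m where "m \<in> M" "x \<in> cyc m" "y \<in> cyc m" "x \<noteq> y"
    by blast
  moreover from this have "m \<in> carrier G" "x \<in> carrier G" "y \<in> carrier G"
    using M_carrier cyc_subset_carrier by blast+
  ultimately show ?E
    unfolding enhanced_power_graph_def snd_conv by blast
qed

lemma fst_graph [simp]: "fst (enhanced_power_graph G) = carrier G"
  by (simp add: enhanced_power_graph_def)

lemma edge_one:
  assumes "x \<in> carrier G" "x \<noteq> \<one>"
  shows "{\<one>, x} \<in> snd (enhanced_power_graph G)" "{x, \<one>} \<in> snd (enhanced_power_graph G)"
  using assms by (auto simp: edge_iff generate.one elim: in_maximal)

lemma edge_in_carrier:
  assumes "{x, y} \<in> snd (enhanced_power_graph G)"
  shows "x \<in> carrier G" "y \<in> carrier G"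
  using assms M_carrier cyc_subset_carrier by (auto simp: edge_iff)

lemma ics_inter:
  assumes "a \<in> ics G M" "m \<in> M" "x \<in> cyc a" "x \<in> cyc m" "x \<noteq> \<one>"
  shows "m = a"
  using assms by (auto simp: ics_def)

lemma ics_in_M: "a \<in> ics G M \<Longrightarrow> a \<in> M"
  by (simp add: ics_def)

lemma edge_within_ics:
  assumes "a \<in> ics G M" "x \<in> cyc a" "x \<noteq> \<one>" "{x, y} \<in> snd (enhanced_power_graph G)"
  shows "y \<in> cyc a"
  using assms ics_inter by (auto simp: edge_iff)

lemma one_not_in_M:
  assumes "x \<in> M" "y \<in> M" "x \<noteq> y"
  shows "x \<noteq> \<one>"
  using in_cyc_imp_eq[of x y] assms generate.one[of G "{y}"] by auto

section \<open>Lower bound: two colours do not suffice\<close>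

lemma rainbow_2_spokes_neq:
  assumes col: "rainbow_colouring (enhanced_power_graph G) k \<zeta>" and k: "k \<le> 2"
    and a: "a \<in> ics G M" and u: "u \<in> cyc a" "u \<noteq> \<one>"
    and v: "v \<in> carrier G" "v \<notin> cyc a"
  shows "\<zeta> {\<one>, u} \<noteq> \<zeta> {\<one>, v}"
proof -
  have "u \<in> carrier G" "u \<noteq> v"
    using a u v ics_in_M M_carrier cyc_subset_carrier by blast+
  then obtain p where p: "ugraph_path (enhanced_power_graph G) u p v"
    "distinct (map \<zeta> (path_edges p))"
    using col v unfolding rainbow_colouring_def fst_graph by blast
  have "p \<noteq> []" "length p \<le> 3"
    using p rainbow_path_length_le[OF col p] k by (auto simp: ugraph_path_def)
  then show ?thesis
  proof (cases p rule: list_length_le_3_cases)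
    case (1 x)
    then show ?thesis using p \<open>u \<noteq> v\<close> by (auto simp: ugraph_path_def)
  next
    case (2 x y)
    then have "{u, v} \<in> snd (enhanced_power_graph G)"
      using p by (auto simp: ugraph_path_def)
    then show ?thesis using edge_within_ics a u v by blast
  next
    case (3 x w z)
    then have e: "p = [u, w, v]" "{u, w} \<in> snd (enhanced_power_graph G)"
      "{w, v} \<in> snd (enhanced_power_graph G)"
      using p by (auto simp: ugraph_path_def)
    \<comment> \<open>The neighbour \<open>w\<close> of \<open>u\<close> lies in
      \<open>cyc a\<close>; if it were nontrivial, its own neighbour \<open>v\<close> would lie
      there too.\<close>
    then have "w = \<one>"
      using edge_within_ics a u v by blast
    then show ?thesis
      using p e by (simp add: insert_commute)
  qed
qed

lemma no_rainbow_2_colouring: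
  assumes "a \<in> ics G M" "b \<in> ics G M" "a \<noteq> b" "c \<in> M" "c \<noteq> a" "c \<noteq> b" "k \<le> 2"
  shows "\<not> rainbow_colouring (enhanced_power_graph G) k \<zeta>"
proof
  assume col: "rainbow_colouring (enhanced_power_graph G) k \<zeta>"
  have M: "a \<in> M" "b \<in> M" "c \<in> M"
    using assms ics_in_M by auto
  have one: "a \<noteq> \<one>" "b \<noteq> \<one>" "c \<noteq> \<one>"
    using M assms one_not_in_M by metis+
  have "b \<notin> cyc a" "c \<notin> cyc a" "c \<notin> cyc b"
    using in_cyc_imp_eq M assms by metis+
  then have neq: "\<zeta> {\<one>, a} \<noteq> \<zeta> {\<one>, b}" "\<zeta> {\<one>, a} \<noteq> \<zeta> {\<one>, c}" "\<zeta> {\<one>, b} \<noteq> \<zeta> {\<one>, c}"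
    using rainbow_2_spokes_neq[OF col \<open>k \<le> 2\<close>] assms M M_carrier self_in_cyc one by blast+
  have "\<zeta> {\<one>, x} \<in> {1, 2}" if "x \<in> {a, b, c}" for x
  proof -
    have "{\<one>, x} \<in> snd (enhanced_power_graph G)"
      using that edge_one M M_carrier one by auto
    then have "\<zeta> {\<one>, x} \<in> {1..k}"
      using col by (auto simp: rainbow_colouring_def)
    then show ?thesis using \<open>k \<le> 2\<close> by auto
  qed
  from this[of a] this[of b] this[of c] neq show False by auto
qed

section \<open>Upper bound: a colouring with three colours\<close>

lemma maximal_non_ics_neighbour:
  assumes "c \<in> M" "c \<notin> ics G M"
  obtains t where "t \<in> cyc c" "t \<noteq> \<one>" "t \<notin> M" "\<And>a. a \<in> ics G M \<Longrightarrow> t \<notin> cyc a"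
proof -
  obtain d where d: "d \<in> M" "d \<noteq> c" "cyc c \<inter> cyc d \<noteq> {\<one>}"
    using assms by (auto simp: ics_def)
  then obtain t where t: "t \<in> cyc c" "t \<in> cyc d" "t \<noteq> \<one>"
    using generate.one by blast
  \<comment> \<open>The nontrivial \<open>t\<close> lies in two different maximal cyclic subgroups,
    which neither an element of \<open>M\<close> nor a nontrivial element of an independent subgroup
    can do.\<close>
  have "t \<notin> M"
    using in_cyc_imp_eq assms d t by metis
  moreover have "t \<notin> cyc a" if "a \<in> ics G M" for a
    using ics_inter[OF that] assms d t by metis
  ultimately show ?thesis using t that by blast
qed

lemma rainbow_3_colouring_exists:
  assumes ics: "ics G M = {a, b}" and "a \<noteq> b"
  shows "\<exists>\<zeta>. rainbow_colouring (enhanced_power_graph G) 3 \<zeta>"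
proof -
  define f :: "'a \<Rightarrow> nat" where
    "f x = (if x \<in> cyc b then 2 else if x \<in> M - cyc a then 3 else 1)" for x
  \<comment> \<open>For an edge at the identity, \<open>the_elem\<close> extracts the label
    \<open>f\<close> of its other end; the value of \<open>f\<close> at the identity itself never
    colours an edge.\<close>
  define \<zeta> where "\<zeta> E = (if \<one> \<in> E then the_elem (f ` (E - {\<one>})) else 2)" for E
  let ?E = "snd (enhanced_power_graph G)"
  have a: "a \<in> ics G M" "a \<in> M" and b: "b \<in> ics G M" "b \<in> M"
    using ics ics_in_M by auto
  have f_range: "f x \<in> {1..3}" for x
    by (simp add: f_def)
  have \<zeta>_one: "\<zeta> {\<one>, x} = f x" "\<zeta> {x, \<one>} = f x" if "x \<noteq> \<one>" for x
  proof -
    have "{\<one>, x} - {\<one>} = {x}" "{x, \<one>} - {\<one>} = {x}"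
      using that by auto
    then show "\<zeta> {\<one>, x} = f x" "\<zeta> {x, \<one>} = f x"
      by (simp_all add: \<zeta>_def)
  qed
  have \<zeta>_other: "\<zeta> {x, y} = 2" if "x \<noteq> \<one>" "y \<noteq> \<one>" for x y
    using that by (simp add: \<zeta>_def)
  have \<zeta>_range: "\<zeta> E \<in> {1..3}" if E: "E \<in> ?E" for E
  proof -
    obtain x y where xy: "E = {x, y}" "x \<noteq> y"
      using E unfolding enhanced_power_graph_def snd_conv by blast
    then show ?thesis
      using \<zeta>_one[of x] \<zeta>_one[of y] \<zeta>_other[of x y] f_range[of x] f_range[of y]
      by (cases "x = \<one>"; cases "y = \<one>") auto
  qed
  have S_neighbour: "\<exists>t. {t, c} \<in> ?E \<and> t \<noteq> \<one> \<and> f t = 1" if c: "f c = 3" for c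
  proof -
    have "c \<in> M" "c \<notin> cyc a" "c \<notin> cyc b"
      using c by (auto simp: f_def split: if_splits)
    moreover from this have "c \<notin> ics G M"
      using ics self_in_cyc by auto
    ultimately obtain t where t: "t \<in> cyc c" "t \<noteq> \<one>" "t \<notin> M" "t \<notin> cyc a" "t \<notin> cyc b"
      using maximal_non_ics_neighbour a b by metis
    then have "{t, c} \<in> ?E"
      using \<open>c \<in> M\<close> self_in_cyc by (auto simp: edge_iff)
    with t show ?thesis by (auto simp: f_def)
  qed
  have T_neighbour: "\<exists>c. {c, t} \<in> ?E \<and> c \<noteq> \<one> \<and> f c = 3"
    if t: "t \<in> carrier G" "t \<notin> cyc a" "f t = 1" for t
  proof -
    \<comment> \<open>Outside \<open>cyc a\<close>, every element of \<open>M\<close> has label 2 or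
      3.\<close>
    have "t \<notin> M" "t \<notin> cyc b"
      using t by (auto simp: f_def split: if_splits)
    obtain c where c: "c \<in> M" "t \<in> cyc c"
      using in_maximal t by blast
    then have "c \<noteq> a" "c \<noteq> b"
      using t \<open>t \<notin> cyc b\<close> by auto
    then have "c \<notin> cyc a" "c \<notin> cyc b" "c \<noteq> \<one>"
      using in_cyc_imp_eq one_not_in_M a b c by metis+
    moreover have "{c, t} \<in> ?E"
      using c \<open>t \<notin> M\<close> self_in_cyc by (auto simp: edge_iff)
    ultimately show ?thesis using c by (auto simp: f_def)
  qed
  have "\<exists>p. ugraph_path (enhanced_power_graph G) u p v \<and> distinct (map \<zeta> (path_edges p))"
    if uv: "u \<in> carrier G" "v \<in> carrier G" "u \<noteq> v" for u v
  proof (cases "{u, v} \<in> ?E")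
    case True
    then show ?thesis
      using uv by (intro exI[of _ "[u, v]"]) (simp add: ugraph_path_def)
  next
    case nonadjacent: False
    then have one: "u \<noteq> \<one>" "v \<noteq> \<one>"
      using uv edge_one by auto
    note spokes = edge_one(2)[OF uv(1) one(1)] edge_one(1)[OF uv(2) one(2)]
    have not_both: "u \<notin> cyc m \<or> v \<notin> cyc m" if "m \<in> M" for m
      using nonadjacent uv that by (auto simp: edge_iff)
    \<comment> \<open>Nonadjacent vertices never share \<open>cyc a\<close> or \<open>cyc b\<close>.
      This excludes a common label 2, and with a common label 1 at least one of them lies outside
      \<open>cyc a\<close>.\<close>
    consider "f u \<noteq> f v" | "f u = 3" "f v = 3" | "f u = 1" "f v = 1" "v \<notin> cyc a"
      | "f u = 1" "f v = 1" "u \<notin> cyc a"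
      using not_both a b by (fastforce simp: f_def split: if_splits)
    then show ?thesis
    proof cases
      case 1
      then show ?thesis
        using uv one spokes
        by (intro exI[of _ "[u, \<one>, v]"]) (auto simp: ugraph_path_def \<zeta>_one)
    next
      case 2
      then obtain t where t: "{t, v} \<in> ?E" "t \<noteq> \<one>" "f t = 1"
        using S_neighbour by blast
      then have "t \<noteq> u" "t \<noteq> v" "t \<in> carrier G"
        using 2 edge_in_carrier by auto
      \<comment> \<open>The colours along this path are 3, 1, 2.\<close>
      then show ?thesis
        using uv one spokes t 2 edge_one[of t]
        by (intro exI[of _ "[u, \<one>, t, v]"]) (auto simp: ugraph_path_def \<zeta>_one \<zeta>_other)
    next
      case 3
      then obtain c where c: "{c, v} \<in> ?E" "c \<noteq> \<one>" "f c = 3"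
        using T_neighbour uv by blast
      then have "c \<noteq> u" "c \<noteq> v" "c \<in> carrier G"
        using 3 edge_in_carrier by auto
      then show ?thesis
        using uv one spokes c 3 edge_one[of c]
        by (intro exI[of _ "[u, \<one>, c, v]"]) (auto simp: ugraph_path_def \<zeta>_one \<zeta>_other)
    next
      \<comment> \<open>Only a vertex outside \<open>cyc a\<close> is known to have a neighbour of
        label 3, so the detour is now taken at \<open>u\<close>, giving the colours 2, 3, 1 instead
        of 1, 3, 2.\<close>
      case 4
      then obtain c where c: "{c, u} \<in> ?E" "c \<noteq> \<one>" "f c = 3"
        using T_neighbour uv by blast
      then have "c \<noteq> u" "c \<noteq> v" "c \<in> carrier G" "{u, c} \<in> ?E"
        using 4 edge_in_carrier by (auto simp: insert_commute)
      then show ?thesis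
        using uv one spokes c 4 edge_one[of c]
        by (intro exI[of _ "[u, c, \<one>, v]"]) (auto simp: ugraph_path_def \<zeta>_one \<zeta>_other)
    qed
  qed
  then have "rainbow_colouring (enhanced_power_graph G) 3 \<zeta>"
    using \<zeta>_range by (auto simp: rainbow_colouring_def)
  then show ?thesis by blast
qed

end

theorem theorem3p4:
  fixes G :: "('a, 'b) monoid_scheme" and M :: "'a set"
  assumes "group G"
    and "finite (carrier G)"
    and "essential_cyclic_set G M"
    and "card M \<ge> 4"
    and "icn G M = 2"
  shows "rainbow_connection_number (enhanced_power_graph G) = 3"
proof -
  interpret finite_group_essential G M
    using assms by (simp add: finite_group_essential_def finite_group_essential_axioms_def)
  obtain a b where ics: "ics G M = {a, b}" "a \<noteq> b"
    using assms(5) by (auto simp: icn_def card_2_iff)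
  have "card {a, b} < card M"
    using assms(4) ics(2) by simp
  then have "\<not> M \<subseteq> {a, b}"
    using card_mono[of "{a, b}" M] by auto
  then obtain c where c: "c \<in> M" "c \<noteq> a" "c \<noteq> b"
    by blast
  show ?thesis
    unfolding rainbow_connection_number_def
  proof (rule Least_equality)
    show "\<exists>\<zeta>. rainbow_colouring (enhanced_power_graph G) 3 \<zeta>"
      using rainbow_3_colouring_exists[OF ics] .
    show "3 \<le> k" if "\<exists>\<zeta>. rainbow_colouring (enhanced_power_graph G) k \<zeta>" for k
      using that no_rainbow_2_colouring[of a b c k] ics c by force
  qed
qed

end
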